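(* Let $\Delta$ be any countable compact subset of $\mathbb{R}$ such that $\partial^{(\infty)}\Delta\ne\emptyset$. Then there exists a well-ordered increasing chain of order type $\mathfrak{c}$ of prime $z$-filters on $\mathbb{R}$ such that each prime $z$-filter in the chain contains $\Delta$ (as an element).
   Context: $\mathfrak{c}=2^{\aleph_0}$, identified with the smallest ordinal of that cardinality. A well-ordered increasing chain of order type $\kappa$ is a family $(\mathcal{Q}_\alpha:\alpha\in\kappa)$ with $\mathcal{Q}_\alpha\subsetneq\mathcal{Q}_\beta$ whenever $\alpha<\beta$ in $\kappa$. For a compact space $K$, $\partial^{(1)}K=\partial K$ is the set of all limit points of $K$, $\partial^{(n+1)}K=\partial(\partial^{(n)}K)$ for $n\ge1$, and $\partial^{(\infty)}K=\bigcap_{n\ge1}\partial^{(n)}K$ (here $\Delta$ is viewed as a compact space in its own right). $\mathbf{Z}(f)=f^{-1}(0)$ and $\mathbf{Z}[\mathbb{R}]=\{\mathbf{Z}(f):f\in C(\mathbb{R})\}$, where $C(\mathbb{R})$ is the algebra of continuous functions on $\mathbb{R}$. A $z$-filter on $\mathbb{R}$ is a non-empty proper subset of $\mathbf{Z}[\mathbb{R}]$ closed under finite intersections and under supersets belonging to $\mathbf{Z}[\mathbb{R}]$. A $z$-filter $\mathcal{P}$ is prime if $Z_1\cup Z_2\notin\mathcal{P}$ whenever $Z_1,Z_2\in\mathbf{Z}[\mathbb{R}]\setminus\mathcal{P}$. *)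

theory Defs
  imports "HOL-Analysis.Analysis"
begin

text \<open>The set of limit points of a compact set \<open>K\<close>, where \<open>K\<close> is viewed as a space in its own
  right (hence the explicit \<open>x \<in> K\<close>).\<close>

definition limit_points :: "'a::topological_space set \<Rightarrow> 'a set" where
  "limit_points K = {x \<in> K. x islimpt K}"

definition iterated_limit_points :: "nat \<Rightarrow> 'a::topological_space set \<Rightarrow> 'a set" where
  "iterated_limit_points n K = (limit_points ^^ n) K"

definition limit_points_infinity :: "'a::topological_space set \<Rightarrow> 'a set" where
  "limit_points_infinity K = (\<Inter>n\<in>{1..}. iterated_limit_points n K)"

definition zero_set :: "(real \<Rightarrow> real) \<Rightarrow> real set" where
  "zero_set f = f -` {0}"

definition zero_sets :: "real set set" where
  "zero_sets = {zero_set f | f. continuous_on UNIV f}"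

definition z_filter :: "real set set \<Rightarrow> bool" where
  "z_filter P \<longleftrightarrow>
     P \<noteq> {} \<and> P \<subset> zero_sets \<and>
     (\<forall>Z1\<in>P. \<forall>Z2\<in>P. Z1 \<inter> Z2 \<in> P) \<and>
     (\<forall>Z1\<in>P. \<forall>Z2\<in>zero_sets. Z1 \<subseteq> Z2 \<longrightarrow> Z2 \<in> P)"

definition prime_z_filter :: "real set set \<Rightarrow> bool" where
  "prime_z_filter P \<longleftrightarrow>
     z_filter P \<and>
     (\<forall>Z1\<in>zero_sets - P. \<forall>Z2\<in>zero_sets - P. Z1 \<union> Z2 \<notin> P)"

text \<open>The ordinal \<open>2 ^ \<aleph>\<^sub>0\<close>. By definition, \<open>card_of A\<close> is a well-order on \<open>A\<close> that
  is minimal among all well-orders on \<open>A\<close>, so its order type is the smallest ordinal of the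
  cardinality of \<open>A\<close>; here \<open>A\<close> is the power set of the natural numbers. The elements of the
  ordinal are thus represented by the elements of \<open>Field continuum\<close> (which is \<open>UNIV\<close>).\<close>

definition continuum :: "nat set rel" where
  "continuum = card_of (UNIV :: nat set set)"

text \<open>A well-ordered increasing chain whose order type is that of the (reflexive) well-order
  \<open>r\<close>, indexed by the elements of \<open>Field r\<close>.\<close>

definition increasing_chain :: "'i rel \<Rightarrow> ('i \<Rightarrow> 'a set) \<Rightarrow> bool" where
  "increasing_chain r Q \<longleftrightarrow>
     Well_order r \<and> (\<forall>\<alpha> \<beta>. (\<alpha>, \<beta>) \<in> r \<and> \<alpha> \<noteq> \<beta> \<longrightarrow> Q \<alpha> \<subset> Q \<beta>)"

end

theory Submission
  imports Defs
begin

text \<open>Prime \<open>z\<close>-filters on \<open>\<real>\<close> are the prime filters of the lattice of closed sets. Since isolated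
  points are dense in a countable compact set, the prime filter theorem yields, below the filter of
  closed sets containing a given point of the \<open>n\<close>-th derivative of \<open>\<Delta>\<close>, a chain
  \<open>R 0 \<subset> \<dots> \<subset> R n\<close> of prime filters in which the \<open>k\<close>-th derivative of \<open>\<Delta>\<close> belongs to \<open>R k\<close> but not
  to \<open>R (k - 1)\<close>. Doing this in pairwise disjoint open sets shrinking to a point of
  \<open>\<partial>\<^sup>\<infinity>\<Delta>\<close>, and taking ultraproducts of the resulting finite chains along functions \<open>f \<alpha>\<close> from an
  independent family, one gets a chain indexed by any linear order on the index set of the family: the
  ultrafilter only has to contain the sets on which \<open>f \<alpha> < f \<beta>\<close>, for \<open>\<alpha>\<close> below \<open>\<beta>\<close>, and these have
  the finite intersection property by independence.\<close>

section \<open>Prime filters in lattices of sets\<close>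

text \<open>Taking \<open>L = UNIV\<close> gives exactly the ultrafilters, since
  \<open>X \<union> - X = UNIV\<close> puts \<open>X\<close> or \<open>- X\<close> into
  \<open>P\<close>. Both index ultrafilters and prime \<open>z\<close>-filters are thus instances of
  one notion.\<close>

definition prime_filter :: "'a set set \<Rightarrow> 'a set set \<Rightarrow> bool" where
  "prime_filter L P \<longleftrightarrow>
     P \<subseteq> L \<and> P \<noteq> {} \<and> {} \<notin> P \<and>
     (\<forall>X\<in>P. \<forall>Y\<in>P. X \<inter> Y \<in> P) \<and>
     (\<forall>X\<in>P. \<forall>Y\<in>L. X \<subseteq> Y \<longrightarrow> Y \<in> P) \<and>
     (\<forall>X\<in>L. \<forall>Y\<in>L. X \<union> Y \<in> P \<longrightarrow> X \<in> P \<or> Y \<in> P)"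

lemma prime_filter_subset: "prime_filter L P \<Longrightarrow> X \<in> P \<Longrightarrow> X \<in> L"
  and prime_filter_nonempty: "prime_filter L P \<Longrightarrow> P \<noteq> {}"
  and prime_filter_empty: "prime_filter L P \<Longrightarrow> {} \<notin> P"
  and prime_filter_Int: "prime_filter L P \<Longrightarrow> X \<in> P \<Longrightarrow> Y \<in> P \<Longrightarrow> X \<inter> Y \<in> P"
  and prime_filter_mono: "prime_filter L P \<Longrightarrow> X \<in> P \<Longrightarrow> Y \<in> L \<Longrightarrow> X \<subseteq> Y \<Longrightarrow> Y \<in> P"
  and prime_filter_Un: "prime_filter L P \<Longrightarrow> X \<in> L \<Longrightarrow> Y \<in> L \<Longrightarrow> X \<union> Y \<in> P \<Longrightarrow> X \<in> P \<or> Y \<in> P"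
  by (auto simp: prime_filter_def)

text \<open>Zorn's lemma gives a filter \<open>P\<close> that is maximal among those extending
  \<open>F\<close> and avoiding \<open>I\<close>; maximality makes it prime, by distributivity.
  Avoiding is phrased through inclusion, so \<open>I\<close> only has to be closed under unions, not
  downwards.\<close>

theorem prime_filter_exists:
  fixes L F I :: "'a set set"
  assumes L_Int: "\<And>X Y. X \<in> L \<Longrightarrow> Y \<in> L \<Longrightarrow> X \<inter> Y \<in> L"
    and F: "F \<subseteq> L" "F \<noteq> {}" "\<And>X Y. X \<in> F \<Longrightarrow> Y \<in> F \<Longrightarrow> X \<inter> Y \<in> F"
    and I: "I \<noteq> {}" "\<And>X Y. X \<in> I \<Longrightarrow> Y \<in> I \<Longrightarrow> X \<union> Y \<in> I"
    and disj: "\<And>X Y. X \<in> F \<Longrightarrow> Y \<in> I \<Longrightarrow> \<not> X \<subseteq> Y"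
  shows "\<exists>P. prime_filter L P \<and> F \<subseteq> P \<and> P \<inter> I = {}"
proof -
  \<comment> \<open>Upward closure is not part of \<open>A\<close>; it follows from maximality,
    through \<open>adjoin\<close>.\<close>
  define A where "A = {G. F \<subseteq> G \<and> G \<subseteq> L \<and> (\<forall>X\<in>G. \<forall>Y\<in>G. X \<inter> Y \<in> G) \<and> (\<forall>X\<in>G. \<forall>Y\<in>I. \<not> X \<subseteq> Y)}"
  have A_D: "F \<subseteq> G" "G \<subseteq> L" "X \<in> G \<Longrightarrow> Y \<in> G \<Longrightarrow> X \<inter> Y \<in> G" "X \<in> G \<Longrightarrow> Y \<in> I \<Longrightarrow> \<not> X \<subseteq> Y"
    if "G \<in> A" for G X Y
    using that by (simp_all add: A_def)
  have "\<exists>M\<in>A. \<forall>X\<in>A. M \<subseteq> X \<longrightarrow> X = M"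
  proof (rule subset_Zorn_nonempty)
    have "F \<in> A"
      unfolding A_def using F(1,3) disj by blast
    then show "A \<noteq> {}"
      by blast
  next
    fix C
    assume C: "C \<noteq> {}" "subset.chain A C"
    then have sub: "C \<subseteq> A" and lin: "\<And>X Y. X \<in> C \<Longrightarrow> Y \<in> C \<Longrightarrow> X \<subseteq> Y \<or> Y \<subseteq> X"
      by (auto simp: subset_chain_def)
    have "X \<inter> Y \<in> \<Union> C" if "X \<in> \<Union> C" "Y \<in> \<Union> C" for X Y
    proof -
      obtain G H where GH: "G \<in> C" "H \<in> C" "X \<in> G" "Y \<in> H"
        using \<open>X \<in> \<Union> C\<close> \<open>Y \<in> \<Union> C\<close> by blast
      then obtain K where "K \<in> C" "X \<in> K" "Y \<in> K"
        using lin[OF GH(1,2)] by blast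
      moreover have "K \<in> A"
        using \<open>K \<in> C\<close> sub by blast
      ultimately show ?thesis
        using A_D(3)[of K X Y] by blast
    qed
    moreover have "F \<subseteq> \<Union> C"
      using C(1) sub A_D(1) by fast
    moreover have "\<Union> C \<subseteq> L"
      using sub A_D(2) by (intro Union_least) blast
    moreover have "\<not> X \<subseteq> Y" if "X \<in> \<Union> C" "Y \<in> I" for X Y
    proof -
      obtain G where "G \<in> C" "X \<in> G"
        using \<open>X \<in> \<Union> C\<close> by blast
      then show ?thesis
        using A_D(4)[of G X Y] sub \<open>Y \<in> I\<close> by blast
    qed
    ultimately show "\<Union> C \<in> A"
      unfolding A_def by simp
  qed
  then obtain P where P: "P \<in> A" and maximal: "\<And>G. G \<in> A \<Longrightarrow> P \<subseteq> G \<Longrightarrow> G = P"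
    by blast
  have PL: "P \<subseteq> L" and FP: "F \<subseteq> P" and P_Int: "\<And>X Y. X \<in> P \<Longrightarrow> Y \<in> P \<Longrightarrow> X \<inter> Y \<in> P"
    and PI: "\<And>X Y. X \<in> P \<Longrightarrow> Y \<in> I \<Longrightarrow> \<not> X \<subseteq> Y"
    using A_D[OF P] by blast+
  \<comment> \<open>Maximality in usable form: if the filter \<open>G\<close> generated by
    \<open>P\<close> and \<open>Z\<close> still avoids \<open>I\<close>, then \<open>Z\<close> is
    already in \<open>P\<close>.\<close>
  have adjoin: "Z \<in> P" if Z: "Z \<in> L" and avoid: "\<And>X Y. X \<in> P \<Longrightarrow> Y \<in> I \<Longrightarrow> \<not> X \<inter> Z \<subseteq> Y" for Z
  proof -
    define G where "G = {Y \<in> L. \<exists>X\<in>P. X \<inter> Z \<subseteq> Y}"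
    have PG: "P \<subseteq> G"
      using PL by (auto simp: G_def)
    have "V \<inter> W \<in> G" if VW: "V \<in> G" "W \<in> G" for V W
    proof -
      obtain X Y where "X \<in> P" "Y \<in> P" "X \<inter> Z \<subseteq> V" "Y \<inter> Z \<subseteq> W"
        using VW by (auto simp: G_def)
      then have "X \<inter> Y \<in> P" "(X \<inter> Y) \<inter> Z \<subseteq> V \<inter> W"
        using P_Int by auto
      then show ?thesis
        using VW L_Int unfolding G_def by blast
    qed
    moreover have "\<not> X \<subseteq> Y" if "X \<in> G" "Y \<in> I" for X Y
    proof
      assume "X \<subseteq> Y"
      obtain V where "V \<in> P" "V \<inter> Z \<subseteq> X"
        using \<open>X \<in> G\<close> by (auto simp: G_def)
      then show False
        using avoid[of V Y] \<open>X \<subseteq> Y\<close> \<open>Y \<in> I\<close> by blast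
    qed
    moreover have "F \<subseteq> G" "G \<subseteq> L"
      using PG FP by (auto simp: G_def)
    ultimately have "G \<in> A"
      by (simp add: A_def)
    moreover have "Z \<in> G"
      using Z F(2) FP by (auto simp: G_def)
    ultimately show ?thesis
      using maximal[of G] PG by blast
  qed
  have P_mono: "Y \<in> P" if "X \<in> P" "Y \<in> L" "X \<subseteq> Y" for X Y
  proof (rule adjoin[OF that(2)])
    show "\<not> W \<inter> Y \<subseteq> V" if "W \<in> P" "V \<in> I" for W V
      using PI[OF P_Int[OF \<open>X \<in> P\<close> \<open>W \<in> P\<close>] \<open>V \<in> I\<close>] \<open>X \<subseteq> Y\<close> by blast
  qed
  have P_Un: "X \<in> P \<or> Y \<in> P" if XY: "X \<in> L" "Y \<in> L" "X \<union> Y \<in> P" for X Y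
  proof (rule ccontr)
    assume "\<not> (X \<in> P \<or> Y \<in> P)"
    then obtain V W V' W' where VW: "V \<in> P" "W \<in> I" "V \<inter> X \<subseteq> W" "V' \<in> P" "W' \<in> I" "V' \<inter> Y \<subseteq> W'"
      using adjoin XY by metis
    then have "(V \<inter> V') \<inter> (X \<union> Y) \<in> P" "W \<union> W' \<in> I"
      using P_Int XY(3) I(2) by simp_all
    moreover have "(V \<inter> V') \<inter> (X \<union> Y) \<subseteq> W \<union> W'"
      using VW by blast
    ultimately show False
      using PI by simp
  qed
  have "{} \<notin> P"
    using PI I(1) by fastforce
  moreover have "P \<noteq> {}"
    using FP F(2) by blast
  ultimately have "prime_filter L P"
    unfolding prime_filter_def using PL P_Int P_mono P_Un by simp
  then show ?thesis
    using FP PI by blast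
qed

text \<open>The finite intersections of members of \<open>S\<close> form a filter base, which is
  separated from the ideal \<open>{{}}\<close> in the full power set.\<close>

lemma ultrafilter_exists:
  fixes S :: "'a set set"
  assumes fip: "\<And>T. finite T \<Longrightarrow> T \<subseteq> S \<Longrightarrow> \<Inter> T \<noteq> {}"
  shows "\<exists>U. prime_filter UNIV U \<and> S \<subseteq> U"
proof -
  define F where "F = {\<Inter> T |T. finite T \<and> T \<subseteq> S}"
  have "X \<inter> Y \<in> F" if XY: "X \<in> F" "Y \<in> F" for X Y
  proof -
    obtain T T' where "X = \<Inter> T" "Y = \<Inter> T'" "finite T" "finite T'" "T \<subseteq> S" "T' \<subseteq> S"
      using XY by (auto simp: F_def)
    then have "X \<inter> Y = \<Inter> (T \<union> T')" "finite (T \<union> T')" "T \<union> T' \<subseteq> S"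
      by auto
    then show ?thesis
      unfolding F_def by blast
  qed
  moreover have "F \<noteq> {}"
    by (auto simp: F_def)
  moreover have "\<not> X \<subseteq> Y" if "X \<in> F" "Y \<in> {{}}" for X Y
    using that fip by (auto simp: F_def)
  ultimately obtain U where U: "prime_filter UNIV U" "F \<subseteq> U"
    using prime_filter_exists[of UNIV F "{{}}"] by auto
  moreover have "S \<subseteq> F"
  proof
    fix X
    assume "X \<in> S"
    then have "X = \<Inter> {X}" "finite {X}" "{X} \<subseteq> S"
      by auto
    then show "X \<in> F"
      unfolding F_def by blast
  qed
  ultimately show ?thesis
    by blast
qed

text \<open>Each clause holds for every \<open>R n\<close> and passes through \<open>U\<close>, as
  in the theorem of Los; the clause on unions uses that \<open>U\<close> is itself prime.\<close>

lemma prime_filter_ultraproduct: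
  fixes U :: "'i set set" and R :: "'i \<Rightarrow> 'a set set"
  assumes U: "prime_filter UNIV U" and R: "\<And>n. prime_filter L (R n)" and "UNIV \<in> L"
  shows "prime_filter L {X \<in> L. {n. X \<in> R n} \<in> U}" (is "prime_filter L ?P")
  unfolding prime_filter_def
proof (intro conjI ballI impI)
  have UU: "UNIV \<in> U"
    using prime_filter_nonempty[OF U] prime_filter_mono[OF U] by blast
  have "UNIV \<in> R n" for n
    using prime_filter_nonempty[OF R] prime_filter_mono[OF R] \<open>UNIV \<in> L\<close> by blast
  then have "UNIV \<in> ?P"
    using UU \<open>UNIV \<in> L\<close> by simp
  then show "?P \<noteq> {}"
    by blast
  show "{} \<notin> ?P"
    using prime_filter_empty[OF R] prime_filter_empty[OF U] by auto
next
  fix X Y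
  assume XY: "X \<in> ?P" "Y \<in> ?P"
  have "{n. X \<in> R n} \<inter> {n. Y \<in> R n} \<in> U"
    using prime_filter_Int[OF U] XY by blast
  then have U_Int: "{n. X \<inter> Y \<in> R n} \<in> U"
    by (rule prime_filter_mono[OF U]) (auto intro: prime_filter_Int[OF R])
  \<comment> \<open>One index \<open>n\<close> with \<open>X \<inter> Y \<in> R n\<close> is enough
    to see that \<open>X \<inter> Y\<close> lies in \<open>L\<close>.\<close>
  then obtain n where "X \<inter> Y \<in> R n"
    using prime_filter_empty[OF U] by (metis empty_Collect_eq)
  then show "X \<inter> Y \<in> ?P"
    using U_Int prime_filter_subset[OF R] by blast
next
  fix X Y
  assume XY: "X \<in> ?P" "Y \<in> L" "X \<subseteq> Y"
  have "{n. Y \<in> R n} \<in> U"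
    by (rule prime_filter_mono[OF U, of "{n. X \<in> R n}"]) (use XY prime_filter_mono[OF R] in auto)
  then show "Y \<in> ?P"
    using XY by simp
next
  fix X Y
  assume XY: "X \<in> L" "Y \<in> L" "X \<union> Y \<in> ?P"
  have "{n. X \<in> R n} \<union> {n. Y \<in> R n} \<in> U"
    by (rule prime_filter_mono[OF U, of "{n. X \<union> Y \<in> R n}"]) (use XY prime_filter_Un[OF R] in auto)
  then show "X \<in> ?P \<or> Y \<in> ?P"
    using prime_filter_Un[OF U] XY by blast
qed auto

section \<open>Zero sets and prime \<open>z\<close>-filters\<close>

lemma zero_sets_eq_closed: "zero_sets = Collect closed"
proof (intro equalityI subsetI CollectI)
  fix Z
  assume "Z \<in> zero_sets"
  then obtain f :: "real \<Rightarrow> real" where "continuous_on UNIV f" "Z = f -` {0}"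
    by (auto simp: zero_sets_def zero_set_def)
  then show "closed Z"
    by (simp add: closed_vimage)
next
  fix Z :: "real set"
  assume "Z \<in> Collect closed"
  then have "closed Z"
    by simp
  show "Z \<in> zero_sets"
  \<comment> \<open>The empty set is treated apart because \<open>infdist x {}\<close> is 0 by
    convention.\<close>
  proof (cases "Z = {}")
    case True
    then have "Z = zero_set (\<lambda>_. 1)"
      by (auto simp: zero_set_def)
    then show ?thesis
      unfolding zero_sets_def using continuous_on_const by blast
  next
    case False
    then have "Z = zero_set (\<lambda>x. infdist x Z)"
      using in_closed_iff_infdist_zero[OF \<open>closed Z\<close>] by (auto simp: zero_set_def)
    moreover have "continuous_on UNIV (\<lambda>x. infdist x Z)"
      by (intro continuous_intros)
    ultimately show ?thesis
      unfolding zero_sets_def by blast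
  qed
qed

lemma prime_z_filterI:
  assumes P: "prime_filter (Collect closed) P"
  shows "prime_z_filter P"
proof -
  have "{} \<in> zero_sets"
    by (simp add: zero_sets_eq_closed)
  then have "P \<subset> zero_sets"
    using prime_filter_subset[OF P] prime_filter_empty[OF P] by (auto simp: zero_sets_eq_closed)
  then have "z_filter P"
    using P by (simp add: z_filter_def zero_sets_eq_closed prime_filter_def)
  then show ?thesis
    unfolding prime_z_filter_def using prime_filter_Un[OF P] by (auto simp: zero_sets_eq_closed)
qed

lemma prime_filter_point: "prime_filter (Collect closed) {Z. closed Z \<and> y \<in> Z}"
  unfolding prime_filter_def by auto

text \<open>Separate \<open>K\<close> from the sets \<open>K' \<union> B\<close> with
  \<open>B\<close> closed and outside \<open>P\<close>. Primality of \<open>P\<close> makes this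
  family closed under unions, and density keeps \<open>K\<close> out of it:
  \<open>K \<subseteq> K' \<union> B\<close> would force \<open>K' \<subseteq> B\<close>, hence
  \<open>B \<in> P\<close>. Avoiding the family yields \<open>K' \<notin> Q\<close> (take
  \<open>B = {}\<close>) and \<open>Q \<subseteq> P\<close> (take for \<open>B\<close> a member of
  \<open>Q\<close> outside \<open>P\<close>).\<close>

lemma prime_filter_step:
  fixes P :: "'a::topological_space set set"
  assumes P: "prime_filter (Collect closed) P" and "K' \<in> P" and "closed K"
    and dense: "\<And>B. closed B \<Longrightarrow> K - K' \<subseteq> B \<Longrightarrow> K' \<subseteq> B"
  shows "\<exists>Q. prime_filter (Collect closed) Q \<and> Q \<subseteq> P \<and> K \<in> Q \<and> K' \<notin> Q"
proof -
  define I where "I = {K' \<union> B |B. closed B \<and> B \<notin> P}"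
  have "closed K'"
    using prime_filter_subset[OF P \<open>K' \<in> P\<close>] by simp
  have "K' \<union> {} \<in> I"
    unfolding I_def using prime_filter_empty[OF P] by blast
  then have K': "K' \<in> I"
    by simp
  have I_Un: "X \<union> Y \<in> I" if "X \<in> I" "Y \<in> I" for X Y
  proof -
    obtain B C where "X = K' \<union> B" "Y = K' \<union> C" "closed B" "closed C" "B \<notin> P" "C \<notin> P"
      using \<open>X \<in> I\<close> \<open>Y \<in> I\<close> by (auto simp: I_def)
    then have "X \<union> Y = K' \<union> (B \<union> C)" "closed (B \<union> C)" "B \<union> C \<notin> P"
      using prime_filter_Un[OF P] by auto
    then show ?thesis
      unfolding I_def by blast
  qed
  have K_I: "\<not> K \<subseteq> Y" if "Y \<in> I" for Y
  proof
    assume "K \<subseteq> Y"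
    obtain B where B: "Y = K' \<union> B" "closed B" "B \<notin> P"
      using \<open>Y \<in> I\<close> by (auto simp: I_def)
    then have "K' \<subseteq> B"
      using dense \<open>K \<subseteq> Y\<close> by blast
    then show False
      using prime_filter_mono[OF P \<open>K' \<in> P\<close>] B by blast
  qed
  have "\<exists>Q. prime_filter (Collect closed) Q \<and> {K} \<subseteq> Q \<and> Q \<inter> I = {}"
  proof (rule prime_filter_exists)
    show "I \<noteq> {}"
      using K' by blast
  qed (use I_Un K_I \<open>closed K\<close> in \<open>simp_all add: closed_Int\<close>)
  then obtain Q where Q: "prime_filter (Collect closed) Q" "K \<in> Q" "Q \<inter> I = {}"
    by blast
  have "Q \<subseteq> P"
  proof
    fix Z
    assume "Z \<in> Q"
    have "closed Z"
      using prime_filter_subset[OF Q(1) \<open>Z \<in> Q\<close>] by simp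
    then have "K' \<union> Z \<in> Q"
      using prime_filter_mono[OF Q(1) \<open>Z \<in> Q\<close>, of "K' \<union> Z"] \<open>closed K'\<close> by (simp add: closed_Un)
    then show "Z \<in> P"
      using Q(3) \<open>closed Z\<close> unfolding I_def by blast
  qed
  then show ?thesis
    using Q K' by blast
qed

text \<open>The chain is built downwards from its top \<open>P\<close>: one step from
  \<open>K (Suc n)\<close> to \<open>K n\<close> gives \<open>Q\<close> below \<open>P\<close>, and
  the induction hypothesis continues from \<open>Q\<close>.\<close>

lemma prime_filter_chain:
  fixes P :: "'a::topological_space set set" and K :: "nat \<Rightarrow> 'a set"
  assumes closed: "\<And>k. closed (K k)"
    and dense: "\<And>k B. closed B \<Longrightarrow> K k - K (Suc k) \<subseteq> B \<Longrightarrow> K (Suc k) \<subseteq> B"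
    and P: "prime_filter (Collect closed) P" "K n \<in> P"
  shows "\<exists>R. R n = P \<and> (\<forall>k\<le>n. prime_filter (Collect closed) (R k) \<and> K k \<in> R k) \<and>
    (\<forall>k\<le>n. \<forall>j<k. R j \<subseteq> R k \<and> K k \<notin> R j)"
  using P
proof (induction n arbitrary: P)
  case 0
  then show ?case
    by (intro exI[of _ "\<lambda>_. P"]) simp
next
  case (Suc n)
  obtain Q where Q: "prime_filter (Collect closed) Q" "Q \<subseteq> P" "K n \<in> Q" "K (Suc n) \<notin> Q"
    using prime_filter_step[OF Suc.prems closed dense] by blast
  obtain R where R: "R n = Q" "\<forall>k\<le>n. prime_filter (Collect closed) (R k) \<and> K k \<in> R k"
    "\<forall>k\<le>n. \<forall>j<k. R j \<subseteq> R k \<and> K k \<notin> R j"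
    using Suc.IH[OF Q(1,3)] by blast
  have "R j \<subseteq> P" if "j \<le> n" for j
    using R(1,3) Q(2) that by (cases "j = n") (use le_neq_implies_less in blast)+
  moreover have "K (Suc n) \<notin> R j" if "j \<le> n" for j
    using R(1,3) Q(4) that by (cases "j = n") (use le_neq_implies_less in blast)+
  ultimately show ?case
    using R Suc.prems by (intro exI[of _ "R(Suc n := P)"]) (auto simp: le_Suc_eq less_Suc_eq_le)
qed

section \<open>Derivatives of countable compact sets\<close>

lemma closed_limit_points:
  fixes K :: "'a::metric_space set"
  assumes "closed K"
  shows "closed (limit_points K)"
proof -
  have "limit_points K = {x. x islimpt K}"
    using assms by (auto simp: limit_points_def closed_limpt)
  then show ?thesis
    by (simp add: closed_limpts)
qed

text \<open>Baire category: were \<open>S\<close> countable, the sets \<open>S - {a}\<close> would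
  be countably many dense open subsets of \<open>S\<close> with empty intersection.\<close>

lemma perfect_imp_uncountable:
  fixes S :: "'a::{real_normed_vector,heine_borel} set"
  assumes "closed S" "S \<noteq> {}" and perfect: "\<And>x. x \<in> S \<Longrightarrow> x islimpt S"
  shows "uncountable S"
proof
  assume "countable S"
  have "S \<subseteq> closure (\<Inter> ((\<lambda>a. S - {a}) ` S))"
  proof (rule Baire)
    fix T
    assume "T \<in> (\<lambda>a. S - {a}) ` S"
    then obtain a where a: "a \<in> S" "T = S - {a}"
      by blast
    have "a islimpt T"
      using perfect[OF a(1)] a(2) islimpt_punctured[of a S] by blast
    then have "a \<in> closure T"
      by (simp add: closure_def)
    then have "S \<subseteq> closure T"
      using a closure_subset[of T] by blast
    moreover have "openin (top_of_set S) T"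
      unfolding a(2) openin_open by (intro exI[of _ "- {a}"]) auto
    ultimately show "openin (top_of_set S) T \<and> S \<subseteq> closure T"
      by blast
  qed (use assms \<open>countable S\<close> in auto)
  moreover have "\<Inter> ((\<lambda>a. S - {a}) ` S) = {}"
    using \<open>S \<noteq> {}\<close> by auto
  ultimately show False
    using \<open>S \<noteq> {}\<close> by simp
qed

text \<open>Otherwise \<open>W = K - B\<close> is nonempty and consists of limit points of
  \<open>K\<close>. As \<open>- B\<close> is open, these are limit points of \<open>W\<close>, so
  \<open>closure W\<close> is a nonempty perfect subset of the countable set
  \<open>K\<close>.\<close>

lemma isolated_points_dense:
  fixes K :: "'a::{real_normed_vector,heine_borel} set"
  assumes "closed K" "countable K" "closed B" and sub: "K - limit_points K \<subseteq> B"
  shows "K \<subseteq> B"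
proof (rule ccontr)
  define W where "W = K - B"
  assume "\<not> K \<subseteq> B"
  then have "closure W \<noteq> {}"
    by (auto simp: W_def)
  have W: "x islimpt W" if "x \<in> W" for x
  proof -
    have "x islimpt K"
      using that sub by (auto simp: W_def limit_points_def)
    moreover have "open (- B)" "x \<in> - B"
      using that \<open>closed B\<close> by (auto simp: W_def)
    ultimately have "x islimpt (K \<inter> - B)"
      by (intro islimpt_Int_eventually eventually_at_in_open')
    then show ?thesis
      by (simp add: W_def Diff_eq)
  qed
  have "x islimpt closure W" if "x \<in> closure W" for x
    using that W by (auto simp: closure_def intro: islimpt_subset)
  then have "uncountable (closure W)"
    using \<open>closure W \<noteq> {}\<close> by (intro perfect_imp_uncountable) auto
  moreover have "closure W \<subseteq> K"
    using \<open>closed K\<close> by (intro closure_minimal) (auto simp: W_def)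
  ultimately show False
    using \<open>countable K\<close> countable_subset by blast
qed

lemma iterated_limit_points_Suc:
  "iterated_limit_points (Suc n) K = limit_points (iterated_limit_points n K)"
  by (simp add: iterated_limit_points_def)

lemma closed_iterated_limit_points:
  fixes K :: "'a::metric_space set"
  shows "closed K \<Longrightarrow> closed (iterated_limit_points n K)"
  by (induction n) (simp_all add: iterated_limit_points_def closed_limit_points)

lemma iterated_limit_points_subset: "iterated_limit_points n K \<subseteq> K"
  by (induction n) (auto simp: iterated_limit_points_def limit_points_def)

text \<open>The sets \<open>B n\<close> are concentric open annuli around a point \<open>x\<close>
  of \<open>limit_points_infinity K\<close>. Since \<open>x\<close> is a limit point of every
  derivative, the radii can be chosen one after another so that the \<open>n\<close>-th annulus
  meets derivative number \<open>h n\<close>.\<close>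

lemma disjoint_open_meeting_derivatives:
  fixes K :: "'a::metric_space set" and h :: "nat \<Rightarrow> nat"
  assumes "limit_points_infinity K \<noteq> {}"
  shows "\<exists>B. (\<forall>n. open (B n) \<and> B n \<inter> iterated_limit_points (h n) K \<noteq> {}) \<and>
    (\<forall>m n. m \<noteq> n \<longrightarrow> B m \<inter> B n = {})"
proof -
  obtain x where x: "x \<in> limit_points_infinity K"
    using assms by blast
  have lim: "x islimpt iterated_limit_points n K" for n
  proof -
    \<comment> \<open>The shift by one turns membership in a derivative into being a limit point of
      the previous one; it also covers \<open>n = 0\<close>, as the intersection starts at
      1.\<close>
    have "x \<in> iterated_limit_points (Suc n) K"
      using x by (auto simp: limit_points_infinity_def)
    then show ?thesis
      by (simp add: iterated_limit_points_Suc limit_points_def)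
  qed
  have "\<exists>d. \<forall>n. 0 < d n \<and> (d (Suc n) < d n \<and>
    (\<exists>y\<in>iterated_limit_points (h n) K. d (Suc n) < dist y x \<and> dist y x < d n))"
  proof (rule dependent_nat_choice)
    show "\<exists>d::real. 0 < d"
      using zero_less_one by blast
  next
    fix d :: real and n :: nat
    assume "0 < d"
    then obtain y where y: "y \<in> iterated_limit_points (h n) K" "y \<noteq> x" "dist y x < d"
      using lim[of "h n"] by (auto simp: islimpt_approachable)
    \<comment> \<open>Half the distance of \<open>y\<close> serves as the next radius, leaving
      \<open>y\<close> strictly inside the annulus.\<close>
    then have "0 < dist y x / 2" "dist y x / 2 < dist y x"
      by auto
    then show "\<exists>d'>0. d' < d \<and> (\<exists>y\<in>iterated_limit_points (h n) K. d' < dist y x \<and> dist y x < d)"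
      using y(1,3) by (meson less_trans)
  qed
  then obtain d where d: "\<And>n. d (Suc n) < d n"
    "\<And>n. \<exists>y\<in>iterated_limit_points (h n) K. d (Suc n) < dist y x \<and> dist y x < d n"
    by blast
  define B where "B n = {y. d (Suc n) < dist y x \<and> dist y x < d n}" for n
  have "open (B n)" for n
    unfolding B_def by (intro open_Collect_conj open_Collect_less continuous_intros)
  moreover have "B n \<inter> iterated_limit_points (h n) K \<noteq> {}" for n
    using d(2)[of n] by (auto simp: B_def)
  moreover have "B m \<inter> B n = {}" if "m < n" for m n
  proof -
    have "d n \<le> d (Suc m)"
      using less_imp_le[OF d(1)] Suc_leI[OF that] by (rule lift_Suc_antimono_le)
    then show ?thesis
      by (auto simp: B_def)
  qed
  then have "B m \<inter> B n = {}" if "m \<noteq> n" for m n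
    using that by (metis inf_commute linorder_neqE_nat)
  ultimately show ?thesis
    by blast
qed

section \<open>Independent functions\<close>

text \<open>Take \<open>m\<close> beyond a separating number for each pair from \<open>F\<close>.
  The trace of \<open>a\<close> below \<open>m\<close> is written as a list because lists of
  naturals form a countable type and can be keys of coded tables.\<close>

lemma finite_sets_separated:
  fixes F :: "nat set set"
  assumes "finite F"
  shows "\<exists>m. inj_on (\<lambda>a. filter (\<lambda>i. i \<in> a) [0..<m]) F"
proof -
  have "\<exists>i. a \<noteq> b \<longrightarrow> i \<in> a \<longleftrightarrow> i \<notin> b" for a b :: "nat set"
    by blast
  then obtain s where s: "\<And>a b :: nat set. a \<noteq> b \<Longrightarrow> s a b \<in> a \<longleftrightarrow> s a b \<notin> b"
    by metis
  define m where "m = Suc (Max (case_prod s ` (F \<times> F)))"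
  have "a = b" if ab: "a \<in> F" "b \<in> F" and eq: "filter (\<lambda>i. i \<in> a) [0..<m] = filter (\<lambda>i. i \<in> b) [0..<m]"
    for a b
  proof (rule ccontr)
    assume "a \<noteq> b"
    have "s a b \<le> Max (case_prod s ` (F \<times> F))"
      using ab \<open>finite F\<close> by (intro Max_ge) auto
    then have "s a b < m"
      by (simp add: m_def)
    moreover have "{i \<in> {0..<m}. i \<in> a} = {i \<in> {0..<m}. i \<in> b}"
      using arg_cong[OF eq, of set] by simp
    ultimately show False
      using s[OF \<open>a \<noteq> b\<close>] by auto
  qed
  then show ?thesis
    by (auto intro: inj_onI)
qed

text \<open>An argument of \<open>f \<alpha>\<close> encodes a number \<open>m\<close> and a finite table, in which the value is looked up
  under the key \<open>\<alpha> \<inter> {..<m}\<close>.\<close>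

lemma independent_functions:
  "\<exists>(f :: nat set \<Rightarrow> nat \<Rightarrow> nat) h. (\<forall>\<alpha> n. f \<alpha> n \<le> h n) \<and>
    (\<forall>F v. finite F \<longrightarrow> (\<exists>n. \<forall>\<alpha>\<in>F. f \<alpha> n = v \<alpha>))"
proof -
  define key where "key m \<alpha> = filter (\<lambda>i. i \<in> \<alpha>) [0..<m]" for m and \<alpha> :: "nat set"
  define tab where "tab n = (from_nat n :: nat \<times> (nat list \<times> nat) list)" for n
  define f where "f \<alpha> n = (case map_of (snd (tab n)) (key (fst (tab n)) \<alpha>) of None \<Rightarrow> 0 | Some k \<Rightarrow> k)"
    for \<alpha> n
  \<comment> \<open>The sum of all values in the table bounds whatever is looked up, including the
    default 0, and does not depend on \<open>\<alpha>\<close>.\<close>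
  define h where "h n = sum_list (map snd (snd (tab n)))" for n
  have "f \<alpha> n \<le> h n" for \<alpha> n
    by (force simp: f_def h_def split: option.split dest!: map_of_SomeD intro!: member_le_sum_list)
  moreover have "\<exists>n. \<forall>\<alpha>\<in>F. f \<alpha> n = v \<alpha>" if "finite F" for F v
  proof -
    obtain m where m: "inj_on (key m) F"
      using finite_sets_separated[OF \<open>finite F\<close>] unfolding key_def by blast
    obtain xs where xs: "set xs = F" "distinct xs"
      using finite_distinct_list[OF \<open>finite F\<close>] by blast
    define t where "t = map (\<lambda>\<alpha>. (key m \<alpha>, v \<alpha>)) xs"
    have "distinct (map fst t)"
      using m xs by (simp add: t_def comp_def distinct_map)
    then have "map_of t (key m \<alpha>) = Some (v \<alpha>)" if "\<alpha> \<in> F" for \<alpha>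
      using that xs by (auto simp: t_def)
    then have "\<forall>\<alpha>\<in>F. f \<alpha> (to_nat (m, t)) = v \<alpha>"
      by (simp add: f_def tab_def)
    then show ?thesis
      by blast
  qed
  ultimately show ?thesis
    by blast
qed

text \<open>The witness, left schematic until the final \<open>show\<close>, counts the strict
  predecessors within \<open>F\<close>. It increases strictly because \<open>\<alpha>\<close>
  precedes \<open>\<beta>\<close> but not itself.\<close>

lemma finite_rank_function:
  assumes "Well_order r" "finite F"
  shows "\<exists>v :: 'a \<Rightarrow> nat. \<forall>\<alpha>\<in>F. \<forall>\<beta>\<in>F. (\<alpha>, \<beta>) \<in> r \<and> \<alpha> \<noteq> \<beta> \<longrightarrow> v \<alpha> < v \<beta>"
proof (intro exI ballI impI)
  have "trans r" "antisym r"
    using assms(1)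
    by (auto simp: well_order_on_def linear_order_on_def partial_order_on_def preorder_on_def)
  fix \<alpha> \<beta>
  assume ab: "\<alpha> \<in> F" "\<beta> \<in> F" "(\<alpha>, \<beta>) \<in> r \<and> \<alpha> \<noteq> \<beta>"
  show "card {\<gamma> \<in> F. (\<gamma>, \<alpha>) \<in> r \<and> \<gamma> \<noteq> \<alpha>} < card {\<gamma> \<in> F. (\<gamma>, \<beta>) \<in> r \<and> \<gamma> \<noteq> \<beta>}"
  proof (rule psubset_card_mono)
    have "(\<gamma>, \<beta>) \<in> r \<and> \<gamma> \<noteq> \<beta>" if "(\<gamma>, \<alpha>) \<in> r" for \<gamma>
      using that ab \<open>trans r\<close> \<open>antisym r\<close> by (meson antisymD transD)
    then show "{\<gamma> \<in> F. (\<gamma>, \<alpha>) \<in> r \<and> \<gamma> \<noteq> \<alpha>} \<subset> {\<gamma> \<in> F. (\<gamma>, \<beta>) \<in> r \<and> \<gamma> \<noteq> \<beta>}"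
      using ab by blast
  qed (use assms in simp)
qed

text \<open>Finitely many of the required sets involve only a finite set \<open>F\<close> of
  indices. Independence gives an \<open>n\<close> at which every \<open>f \<alpha>\<close> with
  \<open>\<alpha> \<in> F\<close> takes the rank of \<open>\<alpha>\<close> in \<open>F\<close> as
  its value, and this \<open>n\<close> lies in all of them.\<close>

lemma increasing_functions_mod_ultrafilter:
  fixes r :: "nat set rel"
  assumes "Well_order r"
  shows "\<exists>(f :: nat set \<Rightarrow> nat \<Rightarrow> nat) h U. prime_filter UNIV U \<and> (\<forall>\<alpha> n. f \<alpha> n \<le> h n) \<and>
    (\<forall>\<alpha> \<beta>. (\<alpha>, \<beta>) \<in> r \<and> \<alpha> \<noteq> \<beta> \<longrightarrow> {n. f \<alpha> n < f \<beta> n} \<in> U)"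
proof -
  obtain f :: "nat set \<Rightarrow> nat \<Rightarrow> nat" and h where h: "\<forall>\<alpha> n. f \<alpha> n \<le> h n"
    and indep: "\<And>F v. finite F \<Longrightarrow> \<exists>n. \<forall>\<alpha>\<in>F. f \<alpha> n = v \<alpha>"
    using independent_functions by blast
  define A where "A = (\<lambda>(\<alpha>, \<beta>). {n. f \<alpha> n < f \<beta> n})"
  have "\<Inter> T \<noteq> {}" if T: "finite T" "T \<subseteq> A ` (r - Id)" for T
  proof -
    obtain E where E: "E \<subseteq> r - Id" "finite E" "T = A ` E"
      using finite_subset_image[OF T] by blast
    define F where "F = fst ` E \<union> snd ` E"
    have "finite F"
      using E by (simp add: F_def)
    then obtain v :: "nat set \<Rightarrow> nat" where v: "\<forall>\<alpha>\<in>F. \<forall>\<beta>\<in>F. (\<alpha>, \<beta>) \<in> r \<and> \<alpha> \<noteq> \<beta> \<longrightarrow> v \<alpha> < v \<beta>"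
      using finite_rank_function[OF assms] by blast
    obtain n where n: "\<forall>\<alpha>\<in>F. f \<alpha> n = v \<alpha>"
      using indep[OF \<open>finite F\<close>] by blast
    have "f \<alpha> n < f \<beta> n" if "(\<alpha>, \<beta>) \<in> E" for \<alpha> \<beta>
    proof -
      have "\<alpha> \<in> F" "\<beta> \<in> F" "(\<alpha>, \<beta>) \<in> r" "\<alpha> \<noteq> \<beta>"
        using that E(1) by (force simp: F_def)+
      then show ?thesis
        using v n by simp
    qed
    then have "n \<in> \<Inter> T"
      by (auto simp: E(3) A_def)
    then show ?thesis
      by blast
  qed
  then have "\<exists>U. prime_filter UNIV U \<and> A ` (r - Id) \<subseteq> U"
    by (rule ultrafilter_exists)
  then obtain U where U: "prime_filter UNIV U" "A ` (r - Id) \<subseteq> U"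
    by blast
  have "{n. f \<alpha> n < f \<beta> n} \<in> U" if "(\<alpha>, \<beta>) \<in> r" "\<alpha> \<noteq> \<beta>" for \<alpha> \<beta>
  proof -
    have "A (\<alpha>, \<beta>) \<in> U"
      using that U(2) by blast
    then show ?thesis
      by (simp add: A_def)
  qed
  then show ?thesis
    using h U(1) by blast
qed

section \<open>The chain\<close>

theorem corollary5p5:
  fixes \<Delta> :: "real set"
  assumes "countable \<Delta>"
    and "compact \<Delta>"
    and "limit_points_infinity \<Delta> \<noteq> {}"
  shows "\<exists>Q :: nat set \<Rightarrow> real set set.
    increasing_chain continuum Q \<and>
    (\<forall>\<alpha>\<in>Field continuum. prime_z_filter (Q \<alpha>) \<and> \<Delta> \<in> Q \<alpha>)"
proof -
  define K where "K k = iterated_limit_points k \<Delta>" for k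
  have "closed \<Delta>"
    using \<open>compact \<Delta>\<close> by (rule compact_imp_closed)
  have K_closed: "closed (K k)" for k
    unfolding K_def using \<open>closed \<Delta>\<close> by (rule closed_iterated_limit_points)
  have K_sub: "K k \<subseteq> \<Delta>" for k
    unfolding K_def by (rule iterated_limit_points_subset)
  \<comment> \<open>Density of isolated points in the countable closed set \<open>K k\<close>, in
    the form required by the chain construction.\<close>
  have K_dense: "K (Suc k) \<subseteq> B" if "closed B" "K k - K (Suc k) \<subseteq> B" for k B
  proof -
    have "countable (K k)"
      using K_sub \<open>countable \<Delta>\<close> by (rule countable_subset)
    then have "K k \<subseteq> B"
      using isolated_points_dense[OF K_closed, of k B] that
      by (simp add: K_def iterated_limit_points_Suc)
    then show ?thesis
      by (auto simp: K_def iterated_limit_points_Suc limit_points_def)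
  qed
  have wo: "Well_order continuum"
    unfolding continuum_def by (rule card_of_Well_order)
  obtain f :: "nat set \<Rightarrow> nat \<Rightarrow> nat" and h U where U: "prime_filter UNIV U"
    and f: "\<forall>\<alpha> n. f \<alpha> n \<le> h n"
      "\<forall>\<alpha> \<beta>. (\<alpha>, \<beta>) \<in> continuum \<and> \<alpha> \<noteq> \<beta> \<longrightarrow> {n. f \<alpha> n < f \<beta> n} \<in> U"
    using increasing_functions_mod_ultrafilter[OF wo] by (elim exE conjE)
  have h: "f \<alpha> n \<le> h n" for \<alpha> n
    using f(1) by simp
  obtain B where B: "\<And>n. open (B n)" "\<And>n. B n \<inter> K (h n) \<noteq> {}" "\<And>m n. m \<noteq> n \<Longrightarrow> B m \<inter> B n = {}"
    using disjoint_open_meeting_derivatives[OF assms(3), of h] unfolding K_def by blast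
  have "\<forall>n. \<exists>R. (\<forall>k\<le>h n. prime_filter (Collect closed) (R k) \<and> K k \<in> R k \<and> - B n \<notin> R k) \<and>
    (\<forall>k\<le>h n. \<forall>j<k. R j \<subseteq> R k \<and> K k \<notin> R j)"
  proof
    fix n
    obtain y where y: "y \<in> B n" "y \<in> K (h n)"
      using B(2)[of n] by blast
    obtain R where R: "R (h n) = {Z. closed Z \<and> y \<in> Z}"
      "\<forall>k\<le>h n. prime_filter (Collect closed) (R k) \<and> K k \<in> R k"
      "\<forall>k\<le>h n. \<forall>j<k. R j \<subseteq> R k \<and> K k \<notin> R j"
      using prime_filter_chain[of K, OF K_closed K_dense prime_filter_point, of "h n" y] y K_closed
      by auto
    \<comment> \<open>The whole chain lies below the filter of the point \<open>y\<close> of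
      \<open>B n\<close>. Hence no \<open>R k\<close> contains \<open>- B n\<close>: the chain is
      concentrated on \<open>B n\<close>.\<close>
    have "R k \<subseteq> {Z. closed Z \<and> y \<in> Z}" if "k \<le> h n" for k
      using that R(1,3) by (cases "k = h n") (auto simp: order_less_le)
    then have "\<forall>k\<le>h n. - B n \<notin> R k"
      using y(1) by blast
    then show "\<exists>R. (\<forall>k\<le>h n. prime_filter (Collect closed) (R k) \<and> K k \<in> R k \<and> - B n \<notin> R k) \<and>
      (\<forall>k\<le>h n. \<forall>j<k. R j \<subseteq> R k \<and> K k \<notin> R j)"
      using R(2,3) by (intro exI[of _ R]) simp
  qed
  from choice[OF this] obtain R where
    "\<forall>n. (\<forall>k\<le>h n. prime_filter (Collect closed) (R n k) \<and> K k \<in> R n k \<and> - B n \<notin> R n k) \<and>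
      (\<forall>k\<le>h n. \<forall>j<k. R n j \<subseteq> R n k \<and> K k \<notin> R n j)"
    by (elim exE)
  then have R: "\<And>n k. k \<le> h n \<Longrightarrow> prime_filter (Collect closed) (R n k)"
    "\<And>n k. k \<le> h n \<Longrightarrow> K k \<in> R n k" "\<And>n k. k \<le> h n \<Longrightarrow> - B n \<notin> R n k"
    "\<And>n k j. k \<le> h n \<Longrightarrow> j < k \<Longrightarrow> R n j \<subseteq> R n k" "\<And>n k j. k \<le> h n \<Longrightarrow> j < k \<Longrightarrow> K k \<notin> R n j"
    by simp_all
  \<comment> \<open>The ultraproduct along \<open>U\<close> of the filters at level
    \<open>f \<alpha> n\<close>; the bound \<open>h n\<close> keeps this level within the
    \<open>n\<close>-th chain.\<close>
  define Q where "Q \<alpha> = {Z \<in> Collect closed. {n. Z \<in> R n (f \<alpha> n)} \<in> U}" for \<alpha>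
  have Q_prime: "prime_filter (Collect closed) (Q \<alpha>)" for \<alpha>
    unfolding Q_def by (rule prime_filter_ultraproduct[OF U]) (use R(1) h in auto)
  have UNIV_U: "UNIV \<in> U"
    using prime_filter_nonempty[OF U] prime_filter_mono[OF U] by blast
  have "\<Delta> \<in> R n (f \<alpha> n)" for n \<alpha>
    using prime_filter_mono[OF R(1) R(2), of "f \<alpha> n" n \<Delta>] h K_sub \<open>closed \<Delta>\<close> by auto
  then have \<Delta>_Q: "\<Delta> \<in> Q \<alpha>" for \<alpha>
    using UNIV_U \<open>closed \<Delta>\<close> by (simp add: Q_def)
  have "Q \<alpha> \<subset> Q \<beta>" if ab: "(\<alpha>, \<beta>) \<in> continuum" "\<alpha> \<noteq> \<beta>" for \<alpha> \<beta>
  proof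
    have less: "{n. f \<alpha> n < f \<beta> n} \<in> U"
      using f(2) ab by simp
    show "Q \<alpha> \<subseteq> Q \<beta>"
    proof
      fix Z
      assume Z: "Z \<in> Q \<alpha>"
      \<comment> \<open>At every index with \<open>f \<alpha> n < f \<beta> n\<close>, the filter at
        level \<open>f \<alpha> n\<close> is contained in the one at level
        \<open>f \<beta> n\<close>.\<close>
      have "{n. Z \<in> R n (f \<alpha> n)} \<inter> {n. f \<alpha> n < f \<beta> n} \<in> U"
        using Z less prime_filter_Int[OF U] by (simp add: Q_def)
      then have "{n. Z \<in> R n (f \<beta> n)} \<in> U"
        by (rule prime_filter_mono[OF U]) (use R(4) h in blast)+
      then show "Z \<in> Q \<beta>"
        using Z by (simp add: Q_def)
    qed
    txt \<open>\<open>- B n\<close> lies in no \<open>R n k\<close>, so for \<open>R n k\<close> only the trace of \<open>D\<close> on \<open>B n\<close> matters, and this is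
      the trace of \<open>K (f \<beta> n)\<close>.\<close>
    define D where "D = (\<Inter>n. K (f \<beta> n) \<union> - B n)"
    have "closed D"
      unfolding D_def using K_closed B(1) by (intro closed_INT ballI closed_Un) auto
    have D_iff: "D \<in> R n k \<longleftrightarrow> K (f \<beta> n) \<in> R n k" if k: "k \<le> h n" for n k
    proof
      assume "D \<in> R n k"
      then have "K (f \<beta> n) \<union> - B n \<in> R n k"
        by (rule prime_filter_mono[OF R(1)[OF k]]) (use K_closed B(1) in \<open>auto simp: D_def\<close>)
      then show "K (f \<beta> n) \<in> R n k"
        using prime_filter_Un[OF R(1)[OF k], of "K (f \<beta> n)" "- B n"] R(3)[OF k] K_closed B(1)
        by (simp add: closed_Compl)
    next
      assume K: "K (f \<beta> n) \<in> R n k"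
      \<comment> \<open>Disjointness of the annuli enters here: for \<open>m \<noteq> n\<close> the
        point \<open>y\<close> of \<open>B n\<close> lies in \<open>- B m\<close>.\<close>
      have "y \<in> D" if y: "y \<in> K (f \<beta> n)" "y \<in> B n" for y
        unfolding D_def
      proof
        show "y \<in> K (f \<beta> m) \<union> - B m" for m
          using y B(3)[of m n] by (cases "m = n") auto
      qed
      then have "K (f \<beta> n) \<subseteq> D \<union> - B n"
        by blast
      then have "D \<union> - B n \<in> R n k"
        using prime_filter_mono[OF R(1)[OF k] K, of "D \<union> - B n"] \<open>closed D\<close> B(1)
        by (simp add: closed_Un closed_Compl)
      then show "D \<in> R n k"
        using prime_filter_Un[OF R(1)[OF k], of D "- B n"] R(3)[OF k] \<open>closed D\<close> B(1)
        by (simp add: closed_Compl)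
    qed
    \<comment> \<open>\<open>D\<close> separates the two filters: \<open>K (f \<beta> n)\<close>
      belongs to the chain at level \<open>f \<beta> n\<close> for every \<open>n\<close>, but not
      at level \<open>f \<alpha> n\<close> when \<open>f \<alpha> n < f \<beta> n\<close>, which
      holds for \<open>U\<close>-almost all \<open>n\<close>.\<close>
    have "D \<in> Q \<beta>"
      using D_iff h R(2) UNIV_U \<open>closed D\<close> by (simp add: Q_def)
    moreover have "D \<notin> Q \<alpha>"
    proof
      assume "D \<in> Q \<alpha>"
      then have "{n. D \<in> R n (f \<alpha> n)} \<inter> {n. f \<alpha> n < f \<beta> n} \<in> U"
        using less prime_filter_Int[OF U] by (simp add: Q_def)
      moreover have "{n. D \<in> R n (f \<alpha> n)} \<inter> {n. f \<alpha> n < f \<beta> n} = {}"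
        using D_iff h R(5) by blast
      ultimately show False
        using prime_filter_empty[OF U] by simp
    qed
    ultimately show "Q \<alpha> \<noteq> Q \<beta>"
      by blast
  qed
  then have "increasing_chain continuum Q"
    using wo by (simp add: increasing_chain_def)
  then show ?thesis
    using Q_prime prime_z_filterI \<Delta>_Q by blast
qed

end
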